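(* (Discrete partial integration.) Let $(\boldsymbol u_n)_{n\ge0}$ and $(\boldsymbol v_n)_{n\ge0}$ be sequences in $\mathbb R^m$ with finite support and consider the $m$-stage Radau IIA Runge--Kutta method. For any $\epsilon>0$ there exists a positive constant $C$, independent of $\tau$, $\boldsymbol u$ and $\boldsymbol v$, such that $$\sum_{n=0}^\infty\rho^n\,\boldsymbol u_n\cdot\boldsymbol v_n\le\sum_{n=0}^\infty\epsilon\,\rho^n\left|\left((\partial_t^\tau)^{-1}\boldsymbol u\right)_n\right|^2+C\rho^n\left|(\partial_t^\tau\boldsymbol v)_n\right|^2 .$$ Here $\partial_t^\tau$ and $(\partial_t^\tau)^{-1}$ denote the convolution quadrature discretizations of the temporal convolutions $L(\partial_t)$ corresponding to $L(s)=s$ and $L(s)=s^{-1}$, respectively.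
   Context: $\mathscr A=(a_{ij})_{i,j=1}^m$, $\boldsymbol b=(b_1,\dots,b_m)^T$, $\boldsymbol c$ are the coefficients of the $m$-stage Radau IIA method, $\tau>0$ is the step size, and $\rho=e^{-\sigma\tau}$ with a fixed real $\sigma>0$. With $\mathbb 1=(1,\dots,1)^T\in\mathbb R^m$ set $\Delta(\zeta)=\bigl(\mathscr A+\tfrac{\zeta}{1-\zeta}\mathbb 1\boldsymbol b^T\bigr)^{-1}\in\mathbb C^{m\times m}$ for $|\zeta|<1$. The convolution quadrature weights $\mathbf W_n(L)$ are defined by the power series $L(\Delta(\zeta)/\tau)=\sum_{n\ge0}\mathbf W_n(L)\zeta^n$, and $(L(\partial_t^\tau)\boldsymbol g)_n=\sum_{j=0}^n\mathbf W_{n-j}(L)\boldsymbol g_j$; thus for $L(s)=s$, $L(s)=s^{-1}$ the generating functions are $\Delta(\zeta)/\tau$ and $\tau\Delta(\zeta)^{-1}$. For $\boldsymbol u,\boldsymbol v\in\mathbb R^m$ the product is weighted: $\boldsymbol u\cdot\boldsymbol v=(\boldsymbol u,\boldsymbol v)_{\boldsymbol b}=\boldsymbol u^T\mathscr B\boldsymbol v=\sum_{i=1}^m b_iu_iv_i$ with $\mathscr B=\operatorname{diag}(b_1,\dots,b_m)$. $|\cdot|$ is the Euclidean norm on $\mathbb R^m$. *)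

theory Defs
  imports "HOL-Analysis.Analysis" "HOL-Computational_Algebra.Polynomial"
begin

text \<open>
  Stages are indexed by a finite type \<open>'m\<close>, so the number of stages is \<open>CARD('m)\<close>.
\<close>

text \<open>The polynomial \<open>d\<^sup>m\<^sup>-\<^sup>1/dx\<^sup>m\<^sup>-\<^sup>1 (x\<^sup>m\<^sup>-\<^sup>1 (x - 1)\<^sup>m)\<close>, whose \<open>m\<close> zeros are the right Radau points
  \<open>0 < c\<^sub>1 < \<dots> < c\<^sub>m = 1\<close>.\<close>

definition radau_poly :: "nat \<Rightarrow> real poly" where
  "radau_poly m = (pderiv ^^ (m - 1)) ([:0, 1:] ^ (m - 1) * [:-1, 1:] ^ m)"

text \<open>
  Radau IIA methods: the nodes are the right Radau points, the weights \<open>b\<close> are given by the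
  quadrature condition \<open>B(m)\<close> and the matrix \<open>A\<close> by the simplifying (collocation) condition
  \<open>C(m)\<close>. As the nodes are distinct, this fixes \<open>A\<close>, \<open>b\<close>, \<open>c\<close> uniquely up to the numbering of the
  stages, which is left arbitrary.
\<close>

definition radau_IIA :: "real^'m^'m \<Rightarrow> real^'m \<Rightarrow> real^'m \<Rightarrow> bool" where
  "radau_IIA A b c \<longleftrightarrow>
     bij_betw (\<lambda>i. c $ i) UNIV {x. poly (radau_poly CARD('m)) x = 0} \<and>
     (\<forall>k\<in>{1..CARD('m)}. (\<Sum>j\<in>UNIV. b $ j * (c $ j) ^ (k - 1)) = 1 / real k) \<and>
     (\<forall>i. \<forall>k\<in>{1..CARD('m)}. (\<Sum>j\<in>UNIV. A $ i $ j * (c $ j) ^ (k - 1)) = (c $ i) ^ k / real k)"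

text \<open>\<open>\<Delta>(\<zeta>) = (A + \<zeta>/(1 - \<zeta>) 1 b\<^sup>T)\<^sup>-\<^sup>1\<close>; the \<open>(i, j)\<close> entry of \<open>1 b\<^sup>T\<close> is \<open>b\<^sub>j\<close>.\<close>

definition rk_Delta :: "real^'m^'m \<Rightarrow> real^'m \<Rightarrow> complex \<Rightarrow> complex^'m^'m" where
  "rk_Delta A b \<zeta> =
     matrix_inv (\<chi> i j. complex_of_real (A $ i $ j) + \<zeta> / (1 - \<zeta>) * complex_of_real (b $ j))"

text \<open>
  The argument \<open>L\<close> is the matrix function belonging to the scalar symbol, i.e. \<open>\<lambda>S. S\<close> for
  \<open>L(s) = s\<close> and \<^const>\<open>matrix_inv\<close> for \<open>L(s) = 1/s\<close>. The weights are the coefficient matrices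
  of the expansion of \<open>L(\<Delta>(\<zeta>)/\<tau>)\<close> on the unit disc; convergence of matrix series is entrywise.
\<close>

definition cq_weights ::
  "(complex^'m^'m \<Rightarrow> complex^'m^'m) \<Rightarrow> real^'m^'m \<Rightarrow> real^'m \<Rightarrow> real \<Rightarrow> nat \<Rightarrow> complex^'m^'m" where
  "cq_weights L A b \<tau> =
     (THE W. \<forall>\<zeta>. norm \<zeta> < 1 \<longrightarrow>
        (\<forall>i j. (\<lambda>n. W n $ i $ j * \<zeta> ^ n) sums (L (rk_Delta A b \<zeta> /\<^sub>R \<tau>) $ i $ j)))"

text \<open>
  The convolution acts on real sequences. Its values are taken in \<open>\<complex>\<^sup>m\<close>, as the weights are
  complex for general \<open>L\<close>; where they are real, the norm of the value is the Euclidean norm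
  on \<open>\<real>\<^sup>m\<close>.
\<close>

definition cq ::
  "(complex^'m^'m \<Rightarrow> complex^'m^'m) \<Rightarrow> real^'m^'m \<Rightarrow> real^'m \<Rightarrow> real \<Rightarrow>
     (nat \<Rightarrow> real^'m) \<Rightarrow> nat \<Rightarrow> complex^'m" where
  "cq L A b \<tau> g n =
     (\<Sum>j=0..n. cq_weights L A b \<tau> (n - j) *v (\<chi> i. complex_of_real (g j $ i)))"

definition weighted_inner :: "real^'m \<Rightarrow> real^'m \<Rightarrow> real^'m \<Rightarrow> real" where
  "weighted_inner b u v = (\<Sum>i\<in>UNIV. b $ i * u $ i * v $ i)"

end

theory Submission
  imports Defs
begin

text \<open>
  A Radau IIA method is stiffly accurate: the stage \<open>e\<close> with node \<open>c\<^sub>e = 1\<close> satisfies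
  \<open>e\<^sup>T A = b\<^sup>T\<close>, because row \<open>e\<close> of the collocation conditions \<open>C(m)\<close> is the quadrature condition
  \<open>B(m)\<close>. Moreover \<open>A\<close> is invertible, because the nodes are distinct and nonzero. Together these
  two properties give
  \[ \Delta(\zeta) = A^{-1} - \zeta A^{-1} 1 e^T, \]
  a matrix polynomial of degree one. Hence both convolutions are governed by one recursion: with
  \<open>U = (\<partial>\<^sub>t\<^sup>\<tau>)\<^sup>-\<^sup>1 u\<close> and \<open>w = \<partial>\<^sub>t\<^sup>\<tau> v\<close>,
  \[ U_n = \tau A u_n + x_n 1, \quad x_{n+1} = e^T U_n, \qquad
     v_n = \tau A w_n + y_n 1, \quad y_{n+1} = e^T v_n, \]
  where \<open>x\<^sub>0 = y\<^sub>0 = 0\<close>. In other words, \<open>U\<close> and \<open>v\<close> are what the method computes when it integrates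
  \<open>u\<close> and \<open>w\<close> from the initial value zero.

  Insert the second recursion into the product:
  \[ u_n \cdot v_n = (\tau u_n) \cdot (A w_n) + (b^T u_n) y_n . \]
  As \<open>\<tau> u\<^sub>n = A\<^sup>-\<^sup>1 (U\<^sub>n - x\<^sub>n 1)\<close> and \<open>x\<^sub>n\<close> is a component of \<open>U\<^sub>n\<^sub>-\<^sub>1\<close>, Cauchy-Schwarz bounds the
  first term by \<open>U\<close> and \<open>w\<close> with a constant that depends on \<open>A\<close> and \<open>b\<close> only. In the second term
  \<open>b\<^sup>T u\<^sub>n = (x\<^sub>n\<^sub>+\<^sub>1 - x\<^sub>n) / \<tau>\<close>, so summation by parts moves the difference quotient to \<open>y\<close>, where it
  becomes \<open>b\<^sup>T w\<^sub>n\<close>; there is no boundary term at infinity because \<open>v\<close> has finite support. The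
  exponential weight leaves the extra term \<open>(1 - \<rho>)/\<tau> \<Sum> \<rho>\<^sup>n x\<^sub>n\<^sub>+\<^sub>1 y\<^sub>n\<^sub>+\<^sub>1\<close>
  (lemma \<open>exponentially_weighted_partial_summation\<close>). Integration costs the factor
  \<open>\<tau> / (1 - r)\<close> with \<open>r = sqrt \<rho>\<close> in the weighted \<open>l\<^sup>2\<close> norm (lemma
  \<open>L2_set_exponential_weight_antiderivative\<close>), and
  \[ \frac{1 - \rho}{\tau} \cdot \frac{\tau}{1 - r} = 1 + r \le 2, \]
  which is why the constant is uniform over all \<open>\<tau> > 0\<close>, large and small. Young's inequality then
  distributes the product of the two norms as \<open>\<epsilon>\<close> and \<open>C\<close>.
\<close>

section \<open>Algebraic properties of Radau IIA methods\<close>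


text \<open>
  The uniqueness of quadrature weights on distinct nodes, that is, the invertibility of the
  Vandermonde matrix: a functional \<open>p \<mapsto> \<Sum> d\<^sub>j p(c\<^sub>j)\<close> that vanishes on all polynomials of degree
  below \<open>m\<close> vanishes on the Lagrange polynomials, which isolate the single \<open>d\<^sub>i\<close>.
\<close>

lemma sum_powers_eq_0_imp_eq_0:
  fixes c d :: "real^'m"
  assumes inj: "inj (\<lambda>i. c $ i)"
    and zero: "\<And>k. k < CARD('m) \<Longrightarrow> (\<Sum>j\<in>UNIV. d $ j * (c $ j) ^ k) = 0"
  shows "d = 0"
proof -
  have poly_zero: "(\<Sum>j\<in>UNIV. d $ j * poly p (c $ j)) = 0" if "degree p < CARD('m)" for p
  proof -
    have "(\<Sum>j\<in>UNIV. d $ j * poly p (c $ j)) =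
        (\<Sum>j\<in>UNIV. \<Sum>k\<le>degree p. coeff p k * (d $ j * (c $ j) ^ k))"
      by (simp add: poly_altdef sum_distrib_left mult_ac)
    also have "\<dots> = (\<Sum>k\<le>degree p. coeff p k * (\<Sum>j\<in>UNIV. d $ j * (c $ j) ^ k))"
      by (subst sum.swap) (simp add: sum_distrib_left)
    also have "\<dots> = 0"
      using that by (intro sum.neutral ballI) (simp add: zero)
    finally show ?thesis .
  qed
  have "d $ i = 0" for i
  proof -
    define l where "l = (\<Prod>j\<in>UNIV - {i}. [:- (c $ j), 1:])"
    have "degree l \<le> (\<Sum>j\<in>UNIV - {i}. degree [:- (c $ j), 1:])"
      unfolding l_def by (rule degree_prod_sum_le[unfolded o_def]) simp
    then have "degree l \<le> CARD('m) - 1"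
      by (simp add: card_Diff_singleton)
    then have "degree l < CARD('m)"
      using zero_less_card_finite[where 'a='m] by linarith
    then have "(\<Sum>j\<in>UNIV. d $ j * poly l (c $ j)) = 0" by (rule poly_zero)
    moreover have "poly l (c $ j) = 0" if "j \<noteq> i" for j
      unfolding l_def poly_prod using that by (intro prod_zero bexI[of _ j]) auto
    ultimately have "d $ i * poly l (c $ i) = 0"
      by (simp add: sum.remove[of UNIV i])
    moreover have "poly l (c $ i) \<noteq> 0"
      unfolding l_def poly_prod using inj by (auto simp: inj_def)
    ultimately show ?thesis by simp
  qed
  then show ?thesis by (simp add: vec_eq_iff)
qed

lemma power_dvd_pderiv_power_Suc:
  fixes p q :: "'a::idom poly"
  assumes "p ^ Suc k dvd q"
  shows "p ^ k dvd pderiv q"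
proof -
  obtain r where "q = p ^ Suc k * r" using assms by (elim dvdE)
  then have "pderiv q = p ^ k * (p * pderiv r + smult (of_nat (Suc k)) (r * pderiv p))"
    by (simp only: pderiv_mult pderiv_power_Suc) (simp add: algebra_simps)
  then show ?thesis by simp
qed

lemma power_dvd_higher_pderiv:
  fixes p q :: "'a::idom poly"
  shows "p ^ (j + k) dvd q \<Longrightarrow> p ^ k dvd (pderiv ^^ j) q"
proof (induction j arbitrary: k)
  case (Suc j)
  then have "p ^ Suc k dvd (pderiv ^^ j) q" by (metis add_Suc_shift)
  then show ?case by (simp add: power_dvd_pderiv_power_Suc)
qed simp

text \<open>
  Each of the \<open>m - 1\<close> derivatives lowers the multiplicity \<open>m\<close> of the zero \<open>1\<close> by at most one.
\<close>

lemma radau_poly_1: "0 < m \<Longrightarrow> poly (radau_poly m) 1 = 0"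
proof -
  assume "0 < m"
  then have "[:-1, 1:] ^ ((m - 1) + 1) dvd [:0, 1:] ^ (m - 1) * [:-1, 1 :: real:] ^ m" by simp
  from power_dvd_higher_pderiv[OF this] show ?thesis
    by (simp add: radau_poly_def poly_eq_0_iff_dvd)
qed

text \<open>
  After \<open>m - 1\<close> derivatives the constant coefficient is \<open>(m - 1)!\<close> times the coefficient of
  \<open>x\<^sup>m\<^sup>-\<^sup>1\<close> in \<open>x\<^sup>m\<^sup>-\<^sup>1 (x - 1)\<^sup>m\<close>, which is \<open>(-1)\<^sup>m\<close>.
\<close>

lemma radau_poly_0: "poly (radau_poly m) 0 \<noteq> 0"
proof -
  have "coeff ([:0, 1:] ^ k * q) k = coeff q 0" for k :: nat and q :: "real poly"
    by (induction k) (simp_all add: mult.assoc)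
  then show ?thesis
    by (simp add: radau_poly_def poly_0_coeff_0 coeff_higher_pderiv coeff_0_power pochhammer_eq_0_iff
        flip: pochhammer_fact)
qed

text \<open>
  For the stage with \<open>c\<^sub>e = 1\<close> the right-hand side \<open>c\<^sub>e\<^sup>k / k\<close> of the collocation condition is the
  right-hand side \<open>1 / k\<close> of the quadrature condition, and these conditions have only one solution.
\<close>

lemma radau_IIA_stiffly_accurate:
  assumes "radau_IIA A b (c :: real^'m)"
  obtains e where "\<And>j. A $ e $ j = b $ j"
proof -
  have bij: "bij_betw (\<lambda>i. c $ i) UNIV {x. poly (radau_poly CARD('m)) x = 0}"
    using assms by (simp add: radau_IIA_def)
  have "1 \<in> range (\<lambda>i. c $ i)"
    using bij by (simp add: bij_betw_def radau_poly_1)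
  then obtain e where e: "c $ e = 1" by (metis rangeE)
  have "(A $ e - b) = 0"
  proof (rule sum_powers_eq_0_imp_eq_0)
    show "inj (\<lambda>i. c $ i)" using bij by (simp add: bij_betw_def)
    fix k assume "k < CARD('m)"
    then have k: "Suc k \<in> {1..CARD('m)}" by simp
    have "(\<Sum>j\<in>UNIV. b $ j * (c $ j) ^ (Suc k - 1)) = 1 / real (Suc k)"
      "(\<Sum>j\<in>UNIV. A $ e $ j * (c $ j) ^ (Suc k - 1)) = (c $ e) ^ Suc k / real (Suc k)"
      using assms k unfolding radau_IIA_def by blast+
    then show "(\<Sum>j\<in>UNIV. (A $ e - b) $ j * (c $ j) ^ k) = 0"
      by (simp add: e left_diff_distrib sum_subtractf)
  qed
  then show ?thesis using that[of e] by simp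
qed

text \<open>
  If \<open>z\<^sup>T A = 0\<close>, then testing with powers of the nodes gives \<open>\<Sum> z\<^sub>i c\<^sub>i\<^sup>k = 0\<close> for \<open>k = 1, \<dots>, m\<close>.
  So the weights \<open>z\<^sub>i c\<^sub>i\<close> vanish, and no node is zero.
\<close>

lemma radau_IIA_invertible:
  assumes "radau_IIA A b (c :: real^'m)"
  shows "invertible A"
proof -
  have bij: "bij_betw (\<lambda>i. c $ i) UNIV {x. poly (radau_poly CARD('m)) x = 0}"
    using assms by (simp add: radau_IIA_def)
  have c0: "c $ i \<noteq> 0" for i
    using bij radau_poly_0[of "CARD('m)"] by (force simp: bij_betw_def)
  have "\<forall>i. z i = 0" if z: "(\<Sum>i\<in>UNIV. z i *s row i A) = 0" for z
  proof -
    have zA: "(\<Sum>i\<in>UNIV. z i * A $ i $ j) = 0" for j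
      using z by (simp add: vec_eq_iff row_def)
    have "(\<chi> i. z i * c $ i) = 0"
    proof (rule sum_powers_eq_0_imp_eq_0)
      show "inj (\<lambda>i. c $ i)" using bij by (simp add: bij_betw_def)
      fix k assume "k < CARD('m)"
      then have k: "Suc k \<in> {1..CARD('m)}" by simp
      have C: "(\<Sum>j\<in>UNIV. A $ i $ j * (c $ j) ^ (Suc k - 1)) = (c $ i) ^ Suc k / real (Suc k)" for i
        using assms k unfolding radau_IIA_def by blast
      have "(\<Sum>i\<in>UNIV. (\<chi> i. z i * c $ i) $ i * (c $ i) ^ k)
          = real (Suc k) * (\<Sum>i\<in>UNIV. z i * ((c $ i) ^ Suc k / real (Suc k)))"
        by (simp add: sum_distrib_left mult_ac del: of_nat_Suc)
      also have "\<dots> = real (Suc k) * (\<Sum>i\<in>UNIV. z i * (\<Sum>j\<in>UNIV. A $ i $ j * (c $ j) ^ (Suc k - 1)))"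
        by (simp only: C)
      also have "\<dots> = real (Suc k) * (\<Sum>j\<in>UNIV. (\<Sum>i\<in>UNIV. z i * A $ i $ j) * (c $ j) ^ k)"
        by (simp add: sum_distrib_left sum_distrib_right mult_ac) (subst sum.swap, simp)
      also have "\<dots> = 0" by (simp add: zA)
      finally show "(\<Sum>i\<in>UNIV. (\<chi> i. z i * c $ i) $ i * (c $ i) ^ k) = 0" .
    qed
    then show ?thesis by (simp add: vec_eq_iff c0)
  qed
  then show ?thesis
    by (simp add: invertible_right_inverse matrix_right_invertible_independent_rows)
qed

section \<open>Convolution quadrature weights\<close>

lemma matrix_inv_eqI:
  fixes M N :: "'a::field^'n^'n"
  assumes "N ** M = mat 1"
  shows "matrix_inv M = N"
proof -
  have "M ** N = mat 1" using assms by (simp add: matrix_left_right_inverse)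
  then have "M ** matrix_inv M = mat 1"
    using someI[of "\<lambda>A'. M ** A' = mat 1 \<and> A' ** M = mat 1" N] assms
    by (simp add: matrix_inv_def)
  then show ?thesis
    by (metis assms matrix_mul_assoc matrix_mul_lid matrix_mul_rid)
qed

definition of_real_vec :: "real^'m \<Rightarrow> complex^'m" where
  "of_real_vec x = (\<chi> i. complex_of_real (x $ i))"

definition of_real_mat :: "real^'n^'m \<Rightarrow> complex^'n^'m" where
  "of_real_mat M = (\<chi> i j. complex_of_real (M $ i $ j))"

lemma norm_of_real_vec: "norm (of_real_vec x) = norm x"
  by (simp add: norm_vec_def of_real_vec_def)

lemma power_series_unit_disc_unique:
  fixes f g :: "nat \<Rightarrow> complex"
  assumes f: "\<And>z. norm z < 1 \<Longrightarrow> (\<lambda>n. f n * z ^ n) sums h z"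
    and g: "\<And>z. norm z < 1 \<Longrightarrow> (\<lambda>n. g n * z ^ n) sums h z"
  shows "f = g"
proof -
  have radius: "fps_conv_radius (Abs_fps a) > 0" if "\<And>z. norm z < 1 \<Longrightarrow> (\<lambda>n. a n * z ^ n) sums h z"
    for a :: "nat \<Rightarrow> complex"
  proof -
    have "summable (\<lambda>n. a n * (1/2) ^ n)" using that[of "1/2"] by (auto simp: summable_def)
    then have "ereal (norm (1/2 :: complex)) \<le> conv_radius a" by (rule conv_radius_geI)
    moreover have "(0::ereal) < ereal (norm (1/2 :: complex))" by simp
    ultimately have "0 < conv_radius a" by (rule less_le_trans[rotated])
    then show ?thesis by (simp add: fps_conv_radius_def)
  qed
  have "Abs_fps f = Abs_fps g"
  proof (rule eval_fps_eqD)
    have "\<forall>\<^sub>F z::complex in nhds 0. z \<in> ball 0 1" by (intro eventually_nhds_in_open) auto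
    then show "\<forall>\<^sub>F z in nhds 0. eval_fps (Abs_fps f) z = eval_fps (Abs_fps g) z"
      by eventually_elim (use f g in \<open>auto simp: eval_fps_def sums_iff\<close>)
  qed (use radius f g in auto)
  then show ?thesis by (metis fps_nth_Abs_fps ext)
qed

lemma cq_weights_eqI:
  assumes W: "\<And>\<zeta> i j. norm \<zeta> < 1 \<Longrightarrow>
    (\<lambda>n. W n $ i $ j * \<zeta> ^ n) sums (L (rk_Delta A b \<zeta> /\<^sub>R \<tau>) $ i $ j)"
  shows "cq_weights L A b \<tau> = W"
  unfolding cq_weights_def
proof (rule the_equality)
  fix V :: "nat \<Rightarrow> complex^'a^'a"
  assume V: "\<forall>\<zeta>. norm \<zeta> < 1 \<longrightarrow>
    (\<forall>i j. (\<lambda>n. V n $ i $ j * \<zeta> ^ n) sums (L (rk_Delta A b \<zeta> /\<^sub>R \<tau>) $ i $ j))"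
  have "(\<lambda>n. V n $ i $ j) = (\<lambda>n. W n $ i $ j)" for i j
    by (rule power_series_unit_disc_unique[where h = "\<lambda>\<zeta>. L (rk_Delta A b \<zeta> /\<^sub>R \<tau>) $ i $ j"])
      (use V W in auto)
  then show "V = W" by (auto simp: fun_eq_iff vec_eq_iff)
qed (use W in blast)

text \<open>
  Real weights keep the convolution of a real sequence real, so that the rest of the argument takes
  place in \<open>\<real>\<^sup>m\<close>.
\<close>

lemma cq_of_real:
  assumes "cq_weights L A b \<tau> = (\<lambda>n. of_real_mat (V n))"
  shows "cq L A b \<tau> g n = of_real_vec (\<Sum>j=0..n. V (n - j) *v g j)"
  by (simp add: cq_def assms vec_eq_iff of_real_vec_def of_real_mat_def matrix_vector_mult_def)

text \<open>
  The formula \<open>\<Delta>(\<zeta>) = A\<^sup>-\<^sup>1 - \<zeta> A\<^sup>-\<^sup>1 1 e\<^sup>T\<close>. With \<open>E = 1 e\<^sup>T\<close>, stiff accuracy reads \<open>1 b\<^sup>T = E A\<close>;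
  hence the matrix to be inverted is \<open>(I + t E) A\<close> with \<open>t = \<zeta> / (1 - \<zeta>)\<close>. As \<open>E\<close> is idempotent and
  \<open>t - \<zeta> - \<zeta> t = 0\<close>, the inverse of \<open>I + t E\<close> is \<open>I - \<zeta> E\<close>.
\<close>

lemma rk_generating_matrix_left_inverse:
  fixes A N :: "real^'m^'m"
  assumes row: "\<And>j. A $ e $ j = b $ j" and inv: "N ** A = mat 1" and "\<zeta> \<noteq> 1"
  shows "(\<chi> i j. complex_of_real (N $ i $ j)
            - \<zeta> * (if j = e then complex_of_real (\<Sum>k\<in>UNIV. N $ i $ k) else 0)) **
         (\<chi> i j. complex_of_real (A $ i $ j) + \<zeta> / (1 - \<zeta>) * complex_of_real (b $ j)) = mat 1"
    (is "?D ** ?M = _")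
proof -
  let ?N = "\<lambda>i k. complex_of_real (N $ i $ k)" and ?A = "\<lambda>i k. complex_of_real (A $ i $ k)"
  define t where "t = \<zeta> / (1 - \<zeta>)"
  have t: "t - \<zeta> - \<zeta> * t = 0" using \<open>\<zeta> \<noteq> 1\<close> by (simp add: t_def field_simps)
  have NA: "(\<Sum>k\<in>UNIV. ?N i k * ?A k j) = (if i = j then 1 else 0)" for i j
  proof -
    have "(N ** A) $ i $ j = (mat 1 :: real^'m^'m) $ i $ j" using inv by simp
    then have "complex_of_real (\<Sum>k\<in>UNIV. N $ i $ k * A $ k $ j) = (if i = j then 1 else 0)"
      by (simp add: matrix_matrix_mult_def mat_def)
    then show ?thesis by simp
  qed
  have "(\<Sum>k\<in>UNIV. (?N i k - \<zeta> * (if k = e then complex_of_real (\<Sum>k\<in>UNIV. N $ i $ k) else 0))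
      * (?A k j + t * complex_of_real (b $ j))) = (if i = j then 1 else 0)" (is "?S = _") for i j
  proof -
    define s where "s = (\<Sum>k\<in>UNIV. ?N i k)"
    have "?S = (\<Sum>k\<in>UNIV. ?N i k * ?A k j) + s * (t * ?A e j)
        - (\<Sum>k\<in>UNIV. (if k = e then \<zeta> * s * (?A k j + t * ?A e j) else 0))"
      unfolding s_def sum_distrib_right row[symmetric] of_real_sum sum.distrib[symmetric] sum_subtractf[symmetric]
      by (intro sum.cong refl) (auto simp: algebra_simps)
    also have "\<dots> = (if i = j then 1 else 0) + s * ?A e j * (t - \<zeta> - \<zeta> * t)"
      by (simp only: NA) (simp add: algebra_simps)
    finally show ?thesis by (simp add: t)
  qed
  then show ?thesis
    by (simp add: matrix_matrix_mult_def mat_def vec_eq_iff t_def)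
qed


lemma scaleR_matrix_mult_inverse_scaleR:
  fixes M N :: "complex^'m^'m"
  assumes "N ** M = mat 1" "\<tau> \<noteq> 0"
  shows "(\<tau> *\<^sub>R N) ** (M /\<^sub>R \<tau>) = mat 1"
proof -
  have "(\<tau> *\<^sub>R N) ** (M /\<^sub>R \<tau>) = N ** M"
    using assms(2) by (simp add: matrix_matrix_mult_def vec_eq_iff)
  then show ?thesis using assms(1) by simp
qed

text \<open>
  Expand \<open>\<tau> (A + \<zeta> / (1 - \<zeta>) 1 b\<^sup>T)\<close> by the geometric series.
\<close>

lemma cq_weights_inverse:
  fixes A N :: "real^'m^'m"
  assumes row: "\<And>j. A $ e $ j = b $ j" and inv: "N ** A = mat 1" and "\<tau> \<noteq> 0"
  shows "cq_weights matrix_inv A b \<tau>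
    = (\<lambda>n. of_real_mat (\<tau> *\<^sub>R (if n = 0 then A else (\<chi> i j. b $ j))))"
proof (rule cq_weights_eqI)
  fix \<zeta> :: complex and i j :: 'm
  assume z: "norm \<zeta> < 1"
  then have "\<zeta> \<noteq> 1" by auto
  note left = rk_generating_matrix_left_inverse[OF row inv this]
  define M where "M = (\<chi> i j. complex_of_real (A $ i $ j) + \<zeta> / (1 - \<zeta>) * complex_of_real (b $ j))"
  have "rk_Delta A b \<zeta> ** M = mat 1"
    unfolding rk_Delta_def M_def matrix_inv_eqI[OF left] by (rule left)
  then have "M ** rk_Delta A b \<zeta> = mat 1" by (simp only: matrix_left_right_inverse)
  then have inv: "matrix_inv (rk_Delta A b \<zeta> /\<^sub>R \<tau>) = \<tau> *\<^sub>R M"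
    by (intro matrix_inv_eqI scaleR_matrix_mult_inverse_scaleR \<open>\<tau> \<noteq> 0\<close>)
  have "(\<lambda>n. \<tau> * b $ j * \<zeta> * \<zeta> ^ n) sums (\<tau> * b $ j * \<zeta> * (1 / (1 - \<zeta>)))"
    by (intro sums_mult geometric_sums z)
  then have "(\<lambda>n. of_real_mat (\<tau> *\<^sub>R (if Suc n = 0 then A else (\<chi> i j. b $ j))) $ i $ j * \<zeta> ^ Suc n)
      sums (\<tau> * (\<zeta> / (1 - \<zeta>) * b $ j))"
    by (simp add: of_real_mat_def mult_ac)
  then show "(\<lambda>n. of_real_mat (\<tau> *\<^sub>R (if n = 0 then A else (\<chi> i j. b $ j))) $ i $ j * \<zeta> ^ n)
      sums (matrix_inv (rk_Delta A b \<zeta> /\<^sub>R \<tau>) $ i $ j)"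
    unfolding inv
    by (subst (asm) sums_Suc_iff) (simp add: M_def of_real_mat_def scaleR_conv_of_real[where 'a=complex] algebra_simps)
qed

lemma cq_weights_identity:
  fixes A N :: "real^'m^'m"
  assumes row: "\<And>j. A $ e $ j = b $ j" and inv: "N ** A = mat 1"
  shows "cq_weights (\<lambda>S. S) A b \<tau>
    = (\<lambda>n. of_real_mat ((if n = 0 then N
          else if n = 1 then (\<chi> i j. if j = e then - (\<Sum>k\<in>UNIV. N $ i $ k) else 0) else 0) /\<^sub>R \<tau>))"
    (is "_ = (\<lambda>n. of_real_mat (?V n /\<^sub>R \<tau>))")
proof (rule cq_weights_eqI)
  fix \<zeta> :: complex and i j :: 'm
  assume "norm \<zeta> < 1"
  then have "\<zeta> \<noteq> 1" by auto
  note D = matrix_inv_eqI[OF rk_generating_matrix_left_inverse[OF row inv this]]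
  have "(\<lambda>n. of_real_mat (?V n /\<^sub>R \<tau>) $ i $ j * \<zeta> ^ n) sums
      (\<Sum>n\<in>{0, 1}. of_real_mat (?V n /\<^sub>R \<tau>) $ i $ j * \<zeta> ^ n)"
    by (rule sums_finite) (auto simp: of_real_mat_def)
  also have "(\<Sum>n\<in>{0, 1}. of_real_mat (?V n /\<^sub>R \<tau>) $ i $ j * \<zeta> ^ n) = (rk_Delta A b \<zeta> /\<^sub>R \<tau>) $ i $ j"
    unfolding rk_Delta_def D
    by (auto simp: of_real_mat_def scaleR_conv_of_real[where 'a=complex] algebra_simps)
  finally show "(\<lambda>n. of_real_mat (?V n /\<^sub>R \<tau>) $ i $ j * \<zeta> ^ n) sums ((rk_Delta A b \<zeta> /\<^sub>R \<tau>) $ i $ j)" .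
qed

section \<open>Both convolutions as Runge-Kutta time stepping\<close>

text \<open>
  The value from which the Runge-Kutta step \<open>n\<close> starts: for a stiffly accurate method it is stage
  \<open>e\<close> of the step before, and \<open>0\<close> at the beginning.
\<close>

definition start_value :: "'m \<Rightarrow> (nat \<Rightarrow> real^'m) \<Rightarrow> nat \<Rightarrow> real" where
  "start_value e g n = (case n of 0 \<Rightarrow> 0 | Suc k \<Rightarrow> g k $ e)"

lemma start_value_simps [simp]:
  "start_value e g 0 = 0" "start_value e g (Suc n) = g n $ e"
  by (simp_all add: start_value_def)

text \<open>
  \<open>F\<close> is the sequence of stage vectors that the method with step size \<open>\<tau>\<close> produces for the
  problem \<open>F' = f\<close>, \<open>F(0) = 0\<close>. The last summand repeats the start value in every stage, as \<open>1\<close> is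
  the vector of ones.
\<close>

definition rk_antiderivative ::
  "real^'m^'m \<Rightarrow> 'm \<Rightarrow> real \<Rightarrow> (nat \<Rightarrow> real^'m) \<Rightarrow> (nat \<Rightarrow> real^'m) \<Rightarrow> bool" where
  "rk_antiderivative A e \<tau> f F \<longleftrightarrow> (\<forall>n. F n = \<tau> *\<^sub>R (A *v f n) + start_value e F n *\<^sub>R 1)"

text \<open>
  The closed form of \<open>U\<close> shows that \<open>U\<close> is constant after the support of \<open>u\<close>, so that its
  exponentially weighted norm is finite although \<open>U\<close> has infinite support in general.
\<close>

lemma cq_inverse_rk_antiderivative:
  fixes A N :: "real^'m^'m"
  assumes row: "\<And>j. A $ e $ j = b $ j" and inv: "N ** A = mat 1" and "\<tau> \<noteq> 0"
  obtains U where "\<And>n. cq matrix_inv A b \<tau> u n = of_real_vec (U n)"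
    and "rk_antiderivative A e \<tau> u U"
    and "\<And>n. U n = \<tau> *\<^sub>R (A *v u n) + (\<tau> * (\<Sum>j<n. b \<bullet> u j)) *\<^sub>R 1"
proof -
  let ?U = "\<lambda>n. \<tau> *\<^sub>R (A *v u n) + (\<tau> * (\<Sum>j<n. b \<bullet> u j)) *\<^sub>R 1"
  have step: "(\<Sum>j=0..n. (\<tau> *\<^sub>R (if n - j = 0 then A else (\<chi> i j. b $ j))) *v u j) = ?U n" for n
  proof -
    have "(\<Sum>j=0..n. (\<tau> *\<^sub>R (if n - j = 0 then A else (\<chi> i j. b $ j))) *v u j)
        = (\<Sum>j<n. (\<tau> *\<^sub>R (if n - j = 0 then A else (\<chi> i j. b $ j))) *v u j) + (\<tau> *\<^sub>R A) *v u n"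
      by (simp add: atLeast0AtMost flip: lessThan_Suc_atMost)
    also have "(\<Sum>j<n. (\<tau> *\<^sub>R (if n - j = 0 then A else (\<chi> i j. b $ j))) *v u j)
        = (\<Sum>j<n. (\<tau> * (b \<bullet> u j)) *\<^sub>R 1)"
      by (intro sum.cong refl)
        (auto simp: vec_eq_iff matrix_vector_mult_def inner_vec_def sum_distrib_left mult_ac)
    also have "(\<tau> *\<^sub>R A) *v u n = \<tau> *\<^sub>R (A *v u n)"
      by (rule scaleR_matrix_vector_assoc[symmetric])
    finally show ?thesis
      by (simp add: sum_distrib_left scaleR_sum_left)
  qed
  have cq: "cq matrix_inv A b \<tau> u n = of_real_vec (?U n)" for n
    by (simp only: cq_of_real[OF cq_weights_inverse[OF assms]] step)
  have "(A *v u n) $ e = b \<bullet> u n" for n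
    by (simp add: matrix_vector_mult_def inner_vec_def row)
  then have "start_value e ?U n = \<tau> * (\<Sum>j<n. b \<bullet> u j)" for n
    by (cases n) (simp_all add: algebra_simps)
  then have rk: "rk_antiderivative A e \<tau> u ?U"
    by (simp add: rk_antiderivative_def)
  show ?thesis by (rule that[of ?U, OF cq rk refl])
qed

text \<open>
  Discrete differentiation inverts discrete integration. The closed form of \<open>w\<close> shows that \<open>w\<close>
  vanishes one step after \<open>v\<close> does.
\<close>

lemma cq_identity_rk_antiderivative:
  fixes A N :: "real^'m^'m"
  assumes row: "\<And>j. A $ e $ j = b $ j" and inv: "N ** A = mat 1" and "\<tau> \<noteq> 0"
  obtains w where "\<And>n. cq (\<lambda>S. S) A b \<tau> v n = of_real_vec (w n)"
    and "rk_antiderivative A e \<tau> w v"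
    and "\<And>n. w n = N *v ((v n - start_value e v n *\<^sub>R 1) /\<^sub>R \<tau>)"
proof -
  let ?w = "\<lambda>n. N *v ((v n - start_value e v n *\<^sub>R 1) /\<^sub>R \<tau>)"
  let ?V = "\<lambda>n. (if n = 0 then N
     else if n = 1 then (\<chi> i j. if j = e then - (\<Sum>k\<in>UNIV. N $ i $ k) else 0) else 0)"
  have scale: "(M /\<^sub>R \<tau>) *v x = (M *v x) /\<^sub>R \<tau>" for M :: "real^'m^'m" and x
    by (rule scaleR_matrix_vector_assoc[symmetric])
  have E: "(\<chi> i j. if j = e then - (\<Sum>k\<in>UNIV. N $ i $ k) else 0) *v x = - (x $ e) *\<^sub>R (N *v 1)" for x
  proof -
    have "(\<Sum>j\<in>UNIV. (if j = e then - S else 0) * x $ j) = - (x $ e) * S" for S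
      by (simp add: if_distrib[of "\<lambda>t. t * _"] cong: if_cong)
    then show ?thesis by (simp add: vec_eq_iff matrix_vector_mult_def)
  qed
  have step: "(\<Sum>j=0..n. (?V (n - j) /\<^sub>R \<tau>) *v v j) = ?w n" for n
  proof (cases n)
    case 0
    then show ?thesis by (simp add: scale matrix_vector_mult_scaleR)
  next
    case (Suc k)
    have "(\<Sum>j=0..n. (?V (n - j) /\<^sub>R \<tau>) *v v j) = (\<Sum>j\<in>{n, k}. (?V (n - j) /\<^sub>R \<tau>) *v v j)"
      using Suc by (intro sum.mono_neutral_right) auto
    also have "\<dots> = (N *v v n - v k $ e *\<^sub>R (N *v 1)) /\<^sub>R \<tau>"
      using Suc by (simp add: scale E scaleR_diff_right)
    finally show ?thesis
      using Suc by (simp add: matrix_vector_mult_scaleR matrix_vector_mult_diff_distrib)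
  qed
  have cq: "cq (\<lambda>S. S) A b \<tau> v n = of_real_vec (?w n)" for n
    by (simp only: cq_of_real[OF cq_weights_identity[OF row inv]] step)
  have "A ** N = mat 1" using inv by (simp add: matrix_left_right_inverse)
  then have rk: "rk_antiderivative A e \<tau> ?w v"
    using \<open>\<tau> \<noteq> 0\<close> by (simp add: rk_antiderivative_def matrix_vector_mul_assoc)
  show ?thesis by (rule that[of ?w, OF cq rk refl])
qed

section \<open>Summation by parts with exponential weights\<close>

lemma L2_set_shift:
  fixes r :: real
  assumes "x 0 = 0" "0 \<le> r"
  shows "L2_set (\<lambda>n. r ^ n * x n) {..<M} \<le> r * L2_set (\<lambda>n. r ^ n * x (Suc n)) {..<M}"
proof -
  have "(\<Sum>n<M. (r ^ n * x n)\<^sup>2) \<le> (\<Sum>n<Suc M. (r ^ n * x n)\<^sup>2)" by simp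
  also have "\<dots> = (\<Sum>n<M. (r ^ Suc n * x (Suc n))\<^sup>2)"
    using assms(1) by (simp only: sum.lessThan_Suc_shift) simp
  finally have "L2_set (\<lambda>n. r ^ n * x n) {..<M} \<le> L2_set (\<lambda>n. r ^ Suc n * x (Suc n)) {..<M}"
    by (simp add: L2_set_def)
  also have "\<dots> = r * L2_set (\<lambda>n. r ^ n * x (Suc n)) {..<M}"
    using assms(2) by (simp add: L2_set_right_distrib mult_ac)
  finally show ?thesis .
qed

text \<open>
  Integration is bounded in the exponentially weighted \<open>l\<^sup>2\<close> norm with the constant
  \<open>\<tau> / (1 - r)\<close>. In \<open>y\<^sub>n\<^sub>+\<^sub>1 = y\<^sub>n + \<tau> \<beta>\<^sub>n\<close> the norm of the shifted sequence \<open>y\<^sub>n\<close> is at most \<open>r\<close> times that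
  of \<open>y\<^sub>n\<^sub>+\<^sub>1\<close>; Minkowski's inequality lets this part be absorbed on the left.
\<close>

lemma L2_set_exponential_weight_antiderivative:
  fixes r \<tau> :: real
  assumes y0: "y 0 = 0" and y: "\<And>n. y (Suc n) = y n + \<tau> * \<beta> n" and "0 \<le> r" "0 \<le> \<tau>"
  shows "(1 - r) * L2_set (\<lambda>n. r ^ n * y (Suc n)) {..<M} \<le> \<tau> * L2_set (\<lambda>n. r ^ n * \<beta> n) {..<M}"
proof -
  have "L2_set (\<lambda>n. r ^ n * y (Suc n)) {..<M}
      = L2_set (\<lambda>n. r ^ n * y n + \<tau> * (r ^ n * \<beta> n)) {..<M}"
    by (simp add: y algebra_simps)
  also have "\<dots> \<le> L2_set (\<lambda>n. r ^ n * y n) {..<M} + L2_set (\<lambda>n. \<tau> * (r ^ n * \<beta> n)) {..<M}"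
    by (rule L2_set_triangle_ineq)
  also have "L2_set (\<lambda>n. \<tau> * (r ^ n * \<beta> n)) {..<M} = \<tau> * L2_set (\<lambda>n. r ^ n * \<beta> n) {..<M}"
    using \<open>0 \<le> \<tau>\<close> by (simp add: L2_set_right_distrib)
  also have "L2_set (\<lambda>n. r ^ n * y n) {..<M} \<le> r * L2_set (\<lambda>n. r ^ n * y (Suc n)) {..<M}"
    by (rule L2_set_shift[of y, OF y0 \<open>0 \<le> r\<close>])
  finally show ?thesis by (simp add: algebra_simps)
qed

lemma sum_mult_le_L2_set: "(\<Sum>n\<in>S. f n * g n) \<le> L2_set f S * L2_set g S" for f g :: "'a \<Rightarrow> real"
proof -
  have "(\<Sum>n\<in>S. f n * g n) \<le> (\<Sum>n\<in>S. \<bar>f n\<bar> * \<bar>g n\<bar>)"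
    by (intro sum_mono) (simp flip: abs_mult)
  then show ?thesis using L2_set_mult_ineq[of f g S] by linarith
qed

lemma exponentially_weighted_partial_summation:
  fixes r :: real
  assumes "x 0 = 0"
  shows "(\<Sum>n<M. (r ^ n)\<^sup>2 * ((x (Suc n) - x n) * y n))
    = (r ^ M)\<^sup>2 * (x M * y M) - (\<Sum>n<M. (r ^ n)\<^sup>2 * (x (Suc n) * (y (Suc n) - y n)))
      + (1 - r\<^sup>2) * (\<Sum>n<M. (r ^ n)\<^sup>2 * (x (Suc n) * y (Suc n)))"
  by (induction M) (simp_all add: assms algebra_simps power2_eq_square)

text \<open>
  The factor \<open>1 - r\<^sup>2 = (1 + r) (1 - r)\<close>, which comes from differencing the weight, compensates the
  \<open>1 / (1 - r)\<close> lost in bounding \<open>y\<close> by its difference quotient \<open>\<beta>\<close>. The constant \<open>3\<close> is \<open>1\<close> for the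
  term with \<open>\<beta>\<close> plus \<open>1 + r \<le> 2\<close> for the term with the differenced weight.
\<close>

lemma scalar_discrete_partial_integration:
  fixes r \<tau> :: real
  assumes x0: "x 0 = 0" and y0: "y 0 = 0" and y: "\<And>n. y (Suc n) = y n + \<tau> * \<beta> n"
    and yM: "y M = 0" and r: "0 \<le> r" "r \<le> 1" and "0 \<le> \<tau>"
  shows "(\<Sum>n<M. (r ^ n)\<^sup>2 * ((x (Suc n) - x n) * y n))
    \<le> 3 * \<tau> * L2_set (\<lambda>n. r ^ n * x (Suc n)) {..<M} * L2_set (\<lambda>n. r ^ n * \<beta> n) {..<M}"
proof -
  define X where "X = L2_set (\<lambda>n. r ^ n * x (Suc n)) {..<M}"
  define Y where "Y = L2_set (\<lambda>n. r ^ n * y (Suc n)) {..<M}"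
  define B where "B = L2_set (\<lambda>n. r ^ n * \<beta> n) {..<M}"
  have X: "0 \<le> X" "0 \<le> Y" "0 \<le> B" by (simp_all add: X_def Y_def B_def)
  have "(\<Sum>n<M. - (r ^ n * x (Suc n)) * (r ^ n * \<beta> n)) \<le> X * B"
    using sum_mult_le_L2_set[of "\<lambda>n. - (r ^ n * x (Suc n))" "\<lambda>n. r ^ n * \<beta> n" "{..<M}"]
    by (simp add: X_def B_def L2_set_def)
  then have "\<tau> * (\<Sum>n<M. - (r ^ n * x (Suc n)) * (r ^ n * \<beta> n)) \<le> \<tau> * (X * B)"
    using \<open>0 \<le> \<tau>\<close> by (rule mult_left_mono)
  also have "\<tau> * (\<Sum>n<M. - (r ^ n * x (Suc n)) * (r ^ n * \<beta> n))
      = - (\<Sum>n<M. (r ^ n)\<^sup>2 * (x (Suc n) * (y (Suc n) - y n)))"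
    by (simp add: y sum_distrib_left sum_negf power2_eq_square mult_ac)
  finally have 1: "- (\<Sum>n<M. (r ^ n)\<^sup>2 * (x (Suc n) * (y (Suc n) - y n))) \<le> \<tau> * (X * B)" .
  have "(\<Sum>n<M. (r ^ n)\<^sup>2 * (x (Suc n) * y (Suc n))) \<le> X * Y"
    using sum_mult_le_L2_set[of "\<lambda>n. r ^ n * x (Suc n)" "\<lambda>n. r ^ n * y (Suc n)" "{..<M}"]
    by (simp add: X_def Y_def power2_eq_square mult_ac)
  moreover have "0 \<le> 1 - r\<^sup>2" using r by (simp add: power_le_one)
  ultimately have "(1 - r\<^sup>2) * (\<Sum>n<M. (r ^ n)\<^sup>2 * (x (Suc n) * y (Suc n))) \<le> (1 - r\<^sup>2) * (X * Y)"
    by (rule mult_left_mono)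
  also have "\<dots> = (1 + r) * X * ((1 - r) * Y)" by (simp add: power2_eq_square algebra_simps)
  also have "\<dots> \<le> (1 + r) * X * (\<tau> * B)"
    using L2_set_exponential_weight_antiderivative[of y, OF y0 y r(1) \<open>0 \<le> \<tau>\<close>] X r
    by (intro mult_left_mono) (simp_all add: Y_def B_def)
  also have "\<dots> \<le> 2 * X * (\<tau> * B)"
    using X r \<open>0 \<le> \<tau>\<close> by (intro mult_right_mono) simp_all
  finally show ?thesis
    using 1 exponentially_weighted_partial_summation[where x = x and y = y and M = M and r = r, OF x0] yM
    by (simp add: X_def B_def mult_ac)
qed

section \<open>Discrete partial integration\<close>

text \<open>
  The estimate in product form. The constant \<open>K\<close> is chosen before \<open>r\<close> and \<open>\<tau>\<close>, which carry the
  dependence on the step size. The final condition says that \<open>v\<close> has died out by step \<open>M\<close>; it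
  removes the boundary term of the summation by parts.
\<close>

lemma discrete_partial_integration_bound:
  fixes A N :: "real^'m^'m"
  assumes row: "\<And>j. A $ e $ j = b $ j" and inv: "N ** A = mat 1"
  shows "\<exists>K>0. \<forall>r \<tau> u U v w M.
      0 \<le> r \<and> r \<le> 1 \<and> 0 < \<tau> \<and> rk_antiderivative A e \<tau> u U \<and> rk_antiderivative A e \<tau> w v
        \<and> start_value e v M = 0 \<longrightarrow>
      (\<Sum>n<M. (r ^ n)\<^sup>2 * weighted_inner b (u n) (v n))
      \<le> K * (L2_set (\<lambda>n. r ^ n * norm (U n)) {..<M} * L2_set (\<lambda>n. r ^ n * norm (w n)) {..<M})"
proof (intro exI conjI allI impI; (elim conjE)?)
  \<comment> \<open>The matrix \<open>diag(b) A\<close>, which puts the weights of the inner product on the side of \<open>w\<close>.\<close>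
  define G :: "real^'m^'m" where "G = (\<chi> i j. b $ i * A $ i $ j)"
  define K1 where "K1 = onorm ((*v) N) * onorm ((*v) G)"
  define s where "s = norm (1 :: real^'m)"
  have nonneg: "0 \<le> K1" "0 \<le> s" "0 \<le> onorm ((*v) N)" "0 \<le> onorm ((*v) G)"
    by (simp_all add: K1_def s_def onorm_pos_le)
  then show "0 < K1 * (1 + s) + 3 * norm b + 1" by (simp add: add_nonneg_pos)
  fix r \<tau> :: real and u U v w :: "nat \<Rightarrow> real^'m" and M :: nat
  assume r: "0 \<le> r" "r \<le> 1" and \<tau>: "0 < \<tau>" and U: "rk_antiderivative A e \<tau> u U"
    and v: "rk_antiderivative A e \<tau> w v" and vM: "start_value e v M = 0"
  define x where "x = start_value e U"
  define y where "y = start_value e v"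
  define R where "R = L2_set (\<lambda>n. r ^ n * norm (U n)) {..<M}"
  define Q where "Q = L2_set (\<lambda>n. r ^ n * norm (w n)) {..<M}"
  define X where "X = L2_set (\<lambda>n. r ^ n * x (Suc n)) {..<M}"
  have pos: "0 \<le> R" "0 \<le> Q" "0 \<le> X" by (simp_all add: R_def Q_def X_def)
  have A_e: "(A *v z) $ e = b \<bullet> z" for z
    by (simp add: matrix_vector_mult_def inner_vec_def row)
  have Un: "U n = \<tau> *\<^sub>R (A *v u n) + x n *\<^sub>R 1" for n
    using U by (simp add: rk_antiderivative_def x_def)
  have vn: "v n = \<tau> *\<^sub>R (A *v w n) + y n *\<^sub>R 1" for n
    using v by (simp add: rk_antiderivative_def y_def)
  have xS: "x (Suc n) = x n + \<tau> * (b \<bullet> u n)" and yS: "y (Suc n) = y n + \<tau> * (b \<bullet> w n)" for n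
    using arg_cong[OF Un[of n], of "\<lambda>z. z $ e"] arg_cong[OF vn[of n], of "\<lambda>z. z $ e"]
    by (simp_all add: x_def y_def A_e)
  have [simp]: "x 0 = 0" "y 0 = 0" by (simp_all add: x_def y_def)

  have L2_abs: "L2_set (\<lambda>n. r ^ n * \<bar>f n\<bar>) {..<M} = L2_set (\<lambda>n. r ^ n * f n) {..<M}" for f
    by (simp add: L2_set_def power_mult_distrib)
  have "L2_set (\<lambda>n. r ^ n * \<bar>x (Suc n)\<bar>) {..<M} \<le> R"
    unfolding R_def
    using r by (intro L2_set_mono mult_left_mono) (simp_all add: x_def component_le_norm_cart)
  then have XR: "X \<le> R" by (simp add: X_def L2_abs)
  have "L2_set (\<lambda>n. r ^ n * x n) {..<M} \<le> r * X"
    unfolding X_def by (rule L2_set_shift) (use r in simp_all)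
  also have "\<dots> \<le> 1 * X" using r pos by (intro mult_right_mono) simp_all
  finally have xR: "L2_set (\<lambda>n. r ^ n * \<bar>x n\<bar>) {..<M} \<le> R" using XR by (simp add: L2_abs)

  \<comment> \<open>The first summand of \<open>v\<^sub>n\<close> only involves data of the same step; the second one is the start
    value and needs summation by parts.\<close>
  have split: "weighted_inner b (u n) (v n)
      = (N *v (U n - x n *\<^sub>R 1)) \<bullet> (G *v w n) + (x (Suc n) - x n) * y n / \<tau>" for n
  proof -
    have "N *v (U n - x n *\<^sub>R 1) = \<tau> *\<^sub>R u n"
      by (simp add: Un matrix_vector_mult_scaleR matrix_vector_mul_assoc inv)
    moreover have "weighted_inner b (u n) (v n) = \<tau> * (u n \<bullet> (G *v w n)) + (b \<bullet> u n) * y n"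
      by (simp add: weighted_inner_def vn G_def inner_vec_def matrix_vector_mult_def sum_distrib_left
          sum_distrib_right algebra_simps sum.distrib)
    ultimately show ?thesis using \<tau> by (simp add: xS)
  qed
  have stage_term: "(r ^ n)\<^sup>2 * ((N *v (U n - x n *\<^sub>R 1)) \<bullet> (G *v w n))
      \<le> K1 * ((r ^ n * norm (U n)) * (r ^ n * norm (w n)) + s * ((r ^ n * \<bar>x n\<bar>) * (r ^ n * norm (w n))))" for n
  proof -
    have "(N *v (U n - x n *\<^sub>R 1)) \<bullet> (G *v w n) \<le> norm (N *v (U n - x n *\<^sub>R 1)) * norm (G *v w n)"
      by (rule norm_cauchy_schwarz)
    also have "\<dots> \<le> (onorm ((*v) N) * (norm (U n) + \<bar>x n\<bar> * s)) * (onorm ((*v) G) * norm (w n))"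
    proof (intro mult_mono)
      have "norm (N *v (U n - x n *\<^sub>R 1)) \<le> onorm ((*v) N) * norm (U n - x n *\<^sub>R 1)"
        by (intro onorm) simp
      also have "norm (U n - x n *\<^sub>R 1) \<le> norm (U n) + \<bar>x n\<bar> * s"
        unfolding s_def norm_scaleR[symmetric] by (rule norm_triangle_ineq4)
      finally show "norm (N *v (U n - x n *\<^sub>R 1)) \<le> onorm ((*v) N) * (norm (U n) + \<bar>x n\<bar> * s)"
        using nonneg by (simp add: mult_left_mono)
      show "norm (G *v w n) \<le> onorm ((*v) G) * norm (w n)" by (intro onorm) simp
    qed (use nonneg in simp_all)
    finally have "(r ^ n)\<^sup>2 * ((N *v (U n - x n *\<^sub>R 1)) \<bullet> (G *v w n)) \<le> (r ^ n)\<^sup>2 *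
        ((onorm ((*v) N) * (norm (U n) + \<bar>x n\<bar> * s)) * (onorm ((*v) G) * norm (w n)))"
      by (rule mult_left_mono) simp
    then show ?thesis by (simp add: K1_def power2_eq_square algebra_simps)
  qed
  have "(\<Sum>n<M. (r ^ n)\<^sup>2 * ((N *v (U n - x n *\<^sub>R 1)) \<bullet> (G *v w n)))
      \<le> K1 * ((\<Sum>n<M. (r ^ n * norm (U n)) * (r ^ n * norm (w n)))
          + s * (\<Sum>n<M. (r ^ n * \<bar>x n\<bar>) * (r ^ n * norm (w n))))"
    unfolding sum_distrib_left sum.distrib[symmetric] distrib_left[symmetric]
    by (rule sum_mono) (rule stage_term)
  also have "\<dots> \<le> K1 * (R * Q + s * (R * Q))"
  proof (intro mult_left_mono add_mono)
    show "(\<Sum>n<M. (r ^ n * norm (U n)) * (r ^ n * norm (w n))) \<le> R * Q"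
      unfolding R_def Q_def by (rule sum_mult_le_L2_set)
    have "(\<Sum>n<M. (r ^ n * \<bar>x n\<bar>) * (r ^ n * norm (w n))) \<le> L2_set (\<lambda>n. r ^ n * \<bar>x n\<bar>) {..<M} * Q"
      unfolding Q_def by (rule sum_mult_le_L2_set)
    also have "\<dots> \<le> R * Q" using xR pos by (intro mult_right_mono)
    finally show "(\<Sum>n<M. (r ^ n * \<bar>x n\<bar>) * (r ^ n * norm (w n))) \<le> R * Q" .
  qed (use nonneg in simp_all)
  finally have 1: "(\<Sum>n<M. (r ^ n)\<^sup>2 * ((N *v (U n - x n *\<^sub>R 1)) \<bullet> (G *v w n)))
      \<le> K1 * (1 + s) * (R * Q)" by (simp add: algebra_simps)

  have "(\<Sum>n<M. (r ^ n)\<^sup>2 * ((x (Suc n) - x n) * y n))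
      \<le> 3 * \<tau> * X * L2_set (\<lambda>n. r ^ n * (b \<bullet> w n)) {..<M}"
    unfolding X_def using r \<tau> vM yS
    by (intro scalar_discrete_partial_integration) (simp_all flip: y_def)
  also have "\<dots> \<le> 3 * \<tau> * R * (norm b * Q)"
  proof (intro mult_mono)
    have "L2_set (\<lambda>n. r ^ n * \<bar>b \<bullet> w n\<bar>) {..<M} \<le> L2_set (\<lambda>n. norm b * (r ^ n * norm (w n))) {..<M}"
    proof (intro L2_set_mono)
      fix n
      have "r ^ n * \<bar>b \<bullet> w n\<bar> \<le> r ^ n * (norm b * norm (w n))"
        using r by (intro mult_left_mono Cauchy_Schwarz_ineq2) simp
      then show "r ^ n * \<bar>b \<bullet> w n\<bar> \<le> norm b * (r ^ n * norm (w n))" by (simp add: mult_ac)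
    qed (use r in simp)
    then show "L2_set (\<lambda>n. r ^ n * (b \<bullet> w n)) {..<M} \<le> norm b * Q"
      by (simp add: L2_abs Q_def L2_set_right_distrib)
  qed (use XR pos \<tau> in simp_all)
  finally have 2: "(\<Sum>n<M. (r ^ n)\<^sup>2 * ((x (Suc n) - x n) * y n)) / \<tau> \<le> 3 * norm b * (R * Q)"
    using \<tau> by (simp add: field_simps)
  have "(\<Sum>n<M. (r ^ n)\<^sup>2 * weighted_inner b (u n) (v n))
      = (\<Sum>n<M. (r ^ n)\<^sup>2 * ((N *v (U n - x n *\<^sub>R 1)) \<bullet> (G *v w n)))
        + (\<Sum>n<M. (r ^ n)\<^sup>2 * ((x (Suc n) - x n) * y n)) / \<tau>"
    by (simp add: split distrib_left sum.distrib sum_divide_distrib)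
  also have "\<dots> \<le> K1 * (1 + s) * (R * Q) + 3 * norm b * (R * Q)" using 1 2 by (rule add_mono)
  also have "\<dots> \<le> (K1 * (1 + s) + 3 * norm b + 1) * (R * Q)"
    using pos by (simp add: algebra_simps)
  finally show "(\<Sum>n<M. (r ^ n)\<^sup>2 * weighted_inner b (u n) (v n))
      \<le> (K1 * (1 + s) + 3 * norm b + 1) *
        (L2_set (\<lambda>n. r ^ n * norm (U n)) {..<M} * L2_set (\<lambda>n. r ^ n * norm (w n)) {..<M})"
    by (simp add: R_def Q_def)
qed

lemma weighted_young_inequality:
  fixes \<epsilon> K p q :: real
  assumes "0 < \<epsilon>"
  shows "K * (p * q) \<le> \<epsilon> * p\<^sup>2 + K\<^sup>2 / (4 * \<epsilon>) * q\<^sup>2"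
proof -
  have "0 \<le> (2 * \<epsilon> * p - K * q)\<^sup>2 / (4 * \<epsilon>)" using assms by simp
  then show ?thesis using assms by (simp add: field_simps power2_eq_square)
qed

theorem lemma5:
  fixes A :: "real^'m^'m" and b c :: "real^'m" and \<sigma> \<epsilon> :: real
  assumes "radau_IIA A b c" and "\<sigma> > 0" and "\<epsilon> > 0"
  shows "\<exists>C>0. \<forall>\<tau>>0. \<forall>(u :: nat \<Rightarrow> real^'m) (v :: nat \<Rightarrow> real^'m).
    finite {n. u n \<noteq> 0} \<longrightarrow> finite {n. v n \<noteq> 0} \<longrightarrow>
    (let \<rho> = exp (- \<sigma> * \<tau>);
         rhs = (\<lambda>n. \<epsilon> * \<rho> ^ n * (norm (cq matrix_inv A b \<tau> u n))\<^sup>2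
                  + C * \<rho> ^ n * (norm (cq (\<lambda>S. S) A b \<tau> v n))\<^sup>2)
     in summable rhs \<and>
        (\<Sum>n. \<rho> ^ n * weighted_inner b (u n) (v n)) \<le> (\<Sum>n. rhs n))"
proof -
  obtain e where row: "\<And>j. A $ e $ j = b $ j"
    using radau_IIA_stiffly_accurate[OF assms(1)] by blast
  obtain N where inv: "N ** A = mat 1"
    using radau_IIA_invertible[OF assms(1)] by (auto simp: invertible_left_inverse)
  obtain K where K: "0 < K" and bound: "\<forall>r \<tau> u U v w M.
      0 \<le> r \<and> r \<le> 1 \<and> 0 < \<tau> \<and> rk_antiderivative A e \<tau> u U \<and> rk_antiderivative A e \<tau> w v
        \<and> start_value e v M = 0 \<longrightarrow>
      (\<Sum>n<M. (r ^ n)\<^sup>2 * weighted_inner b (u n) (v n))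
      \<le> K * (L2_set (\<lambda>n. r ^ n * norm (U n)) {..<M} * L2_set (\<lambda>n. r ^ n * norm (w n)) {..<M})"
    using discrete_partial_integration_bound[OF row inv] by blast
  define C where "C = K\<^sup>2 / (4 * \<epsilon>)"
  have "0 < C" using K \<open>\<epsilon> > 0\<close> by (simp add: C_def)
  moreover have "summable rhs \<and> (\<Sum>n. \<rho> ^ n * weighted_inner b (u n) (v n)) \<le> (\<Sum>n. rhs n)"
    if \<tau>: "0 < \<tau>" and u: "finite {n. u n \<noteq> 0}" and v: "finite {n. v n \<noteq> 0}"
      and \<rho>_def: "\<rho> = exp (- \<sigma> * \<tau>)"
      and rhs_def: "rhs = (\<lambda>n. \<epsilon> * \<rho> ^ n * (norm (cq matrix_inv A b \<tau> u n))\<^sup>2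
                  + C * \<rho> ^ n * (norm (cq (\<lambda>S. S) A b \<tau> v n))\<^sup>2)"
    for \<tau> \<rho> :: real and u v :: "nat \<Rightarrow> real^'m" and rhs
  proof -
    have "\<tau> \<noteq> 0" using \<tau> by simp
    have \<rho>: "0 < \<rho>" "\<rho> < 1" using \<tau> \<open>\<sigma> > 0\<close> by (simp_all add: \<rho>_def)
    \<comment> \<open>The weight \<open>\<rho>\<^sup>n\<close> is split evenly between the two factors of each product.\<close>
    define r where "r = sqrt \<rho>"
    have r: "0 \<le> r" "r \<le> 1" using \<rho> by (simp_all add: r_def)
    have r2: "(r ^ n)\<^sup>2 = \<rho> ^ n" for n
    proof -
      have "(r ^ n)\<^sup>2 = (r\<^sup>2) ^ n" by (simp add: mult.commute flip: power_mult)
      then show ?thesis using \<rho> by (simp add: r_def)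
    qed
    obtain U where cqU: "\<And>n. cq matrix_inv A b \<tau> u n = of_real_vec (U n)"
      and U: "rk_antiderivative A e \<tau> u U"
      and Un: "\<And>n. U n = \<tau> *\<^sub>R (A *v u n) + (\<tau> * (\<Sum>j<n. b \<bullet> u j)) *\<^sub>R 1"
      using cq_inverse_rk_antiderivative[OF row inv \<open>\<tau> \<noteq> 0\<close>, of u] by blast
    obtain w where cqw: "\<And>n. cq (\<lambda>S. S) A b \<tau> v n = of_real_vec (w n)"
      and w: "rk_antiderivative A e \<tau> w v"
      and wn: "\<And>n. w n = N *v ((v n - start_value e v n *\<^sub>R 1) /\<^sub>R \<tau>)"
      using cq_identity_rk_antiderivative[OF row inv \<open>\<tau> \<noteq> 0\<close>, of v] by blast
    have "finite ({n. u n \<noteq> 0} \<union> {n. v n \<noteq> 0})" using u v by simp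
    then obtain m where m: "{n. u n \<noteq> 0} \<union> {n. v n \<noteq> 0} \<subseteq> {..<m}"
      by (metis finite_nat_iff_bounded)
    have zero: "u n = 0" "v n = 0" if "m \<le> n" for n using m that by force+
    \<comment> \<open>One step more than the supports of \<open>u\<close> and \<open>v\<close>, as \<open>w\<close> depends on the previous value of \<open>v\<close>.\<close>
    define M where "M = Suc m"
    have vM: "start_value e v n = 0" if "M \<le> n" for n
      using that zero by (cases n) (auto simp: M_def)
    have wM: "w n = 0" if "M \<le> n" for n
      using that zero(2)[of n] vM[OF that] by (simp add: wn M_def)
    have UM: "U n = (\<tau> * (\<Sum>j<m. b \<bullet> u j)) *\<^sub>R 1" if "m \<le> n" for n
    proof -
      have "(\<Sum>j<n. b \<bullet> u j) = (\<Sum>j<m. b \<bullet> u j)"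
        using that zero(1) by (intro sum.mono_neutral_right) auto
      then show ?thesis using zero(1)[OF that] by (simp add: Un)
    qed
    have rhs: "rhs n = \<epsilon> * (r ^ n * norm (U n))\<^sup>2 + C * (r ^ n * norm (w n))\<^sup>2" for n
      by (simp add: rhs_def cqU cqw norm_of_real_vec power_mult_distrib r2 mult_ac)
    have rhs_nonneg: "0 \<le> rhs n" for n
      using \<open>\<epsilon> > 0\<close> \<open>0 < C\<close> by (simp add: rhs)
    have "summable (\<lambda>n. (\<epsilon> * (norm (U m))\<^sup>2) * \<rho> ^ n)"
      using \<rho> by (intro summable_mult summable_geometric) simp
    moreover have "rhs n = (\<epsilon> * (norm (U m))\<^sup>2) * \<rho> ^ n" if "M \<le> n" for n
      using that wM[OF that] UM[of n] UM[of m]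
      by (simp add: rhs power_mult_distrib r2 M_def mult_ac)
    ultimately have summable: "summable rhs"
      by (subst summable_cong[where g = "\<lambda>n. (\<epsilon> * (norm (U m))\<^sup>2) * \<rho> ^ n"])
        (auto simp: eventually_sequentially)

    have "(\<Sum>n. \<rho> ^ n * weighted_inner b (u n) (v n)) = (\<Sum>n<M. \<rho> ^ n * weighted_inner b (u n) (v n))"
      using zero by (intro suminf_finite) (auto simp: M_def weighted_inner_def)
    also have "\<dots> \<le> K * (L2_set (\<lambda>n. r ^ n * norm (U n)) {..<M} * L2_set (\<lambda>n. r ^ n * norm (w n)) {..<M})"
      using bound[rule_format, of r \<tau> u U w v M] r \<tau> U w vM[of M]
      by (simp add: r2)
    also have "\<dots> \<le> \<epsilon> * (L2_set (\<lambda>n. r ^ n * norm (U n)) {..<M})\<^sup>2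
        + C * (L2_set (\<lambda>n. r ^ n * norm (w n)) {..<M})\<^sup>2"
      unfolding C_def using \<open>\<epsilon> > 0\<close> by (rule weighted_young_inequality)
    also have "\<dots> = (\<Sum>n<M. rhs n)"
      by (simp add: rhs L2_set_def sum_nonneg sum.distrib sum_distrib_left)
    also have "\<dots> \<le> (\<Sum>n. rhs n)"
      using summable rhs_nonneg by (intro sum_le_suminf) auto
    finally show ?thesis using summable by simp
  qed
  ultimately show ?thesis
    unfolding Let_def by blast
qed

end
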